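(* The map $\Phi_x(u):=u+\frac{x}{1-u}$ is invertible on the set of formal power series in $x$ with zero constant term. Its inverse is $$\Psi_x(v):=\frac{1+v-\sqrt{(1-v)^2+4x}}{2},$$ where the square root is the one with constant term $1$; it is characterised by $\Phi_x(\Psi_x(v))=v$ together with $\Psi_x(v)$ having zero constant term. Consequently $$T(x)=\Psi_x^{\,3}\bigl(G(x)\bigr),\qquad G(x)=\frac{1-\sqrt{1-16x}}{2},$$ where $\Psi_x^{\,3}$ denotes the threefold iterate of $\Psi_x$.
   Context: Let $V_4=\{0<a<b<1\}$ be a four-element chain with Gödel implication $x\Rightarrow_G y=1$ if $x\le y$ and $x\Rightarrow_G y=y$ if $x>y$. For $n\ge1$, consider the $C_{n-1}$ full bracketings of $p_1\Rightarrow_G p_2\Rightarrow_G\cdots\Rightarrow_G p_n$ in $n$ distinct variables (equivalently, full binary trees with $n$ ordered leaves $p_1,\dots,p_n$), where $C_k$ is the $k$-th Catalan number. Let $t_n$ be the number of pairs (bracketing, valuation $\{p_1,\dots,p_n\}\to V_4$) for which the bracketed formula evaluates to $1$, and let $g_n=4^nC_{n-1}$ be the total number of such pairs. Put $T(x)=\sum_{n\ge1}t_nx^n$ and $G(x)=\sum_{n\ge1}g_nx^n$ (formal power series). *)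

theory Defs
  imports "HOL-Library.FuncSet" "HOL-Computational_Algebra.Formal_Power_Series"
begin

datatype V4 = V0 | Va | Vb | V1

instantiation V4 :: linorder
begin

fun rank_V4 :: "V4 \<Rightarrow> nat" where
  "rank_V4 V0 = 0"
| "rank_V4 Va = 1"
| "rank_V4 Vb = 2"
| "rank_V4 V1 = 3"

definition less_eq_V4 :: "V4 \<Rightarrow> V4 \<Rightarrow> bool" where
  "x \<le> y \<longleftrightarrow> rank_V4 x \<le> rank_V4 y"

definition less_V4 :: "V4 \<Rightarrow> V4 \<Rightarrow> bool" where
  "x < y \<longleftrightarrow> rank_V4 x < rank_V4 y"

instance
proof
  fix x y :: V4
  show "x \<le> y \<Longrightarrow> y \<le> x \<Longrightarrow> x = y"
    by (cases x; cases y) (auto simp: less_eq_V4_def)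
qed (auto simp: less_eq_V4_def less_V4_def)

end

lemma V4_chain: "V0 < Va" "Va < Vb" "Vb < V1"
  by (simp_all add: less_V4_def)

lemma UNIV_V4: "UNIV = {V0, Va, Vb, V1}"
  using V4.exhaust by auto

lemma card_UNIV_V4: "card (UNIV :: V4 set) = 4"
  by (simp add: UNIV_V4)

definition godel_imp :: "V4 \<Rightarrow> V4 \<Rightarrow> V4" where
  "godel_imp x y = (if x \<le> y then V1 else y)"

datatype form = Var nat | Imp form form

fun leaves :: "form \<Rightarrow> nat list" where
  "leaves (Var i) = [i]"
| "leaves (Imp \<phi> \<psi>) = leaves \<phi> @ leaves \<psi>"

fun eval :: "(nat \<Rightarrow> V4) \<Rightarrow> form \<Rightarrow> V4" where
  "eval \<nu> (Var i) = \<nu> i"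
| "eval \<nu> (Imp \<phi> \<psi>) = godel_imp (eval \<nu> \<phi>) (eval \<nu> \<psi>)"

definition bracketings :: "nat \<Rightarrow> form set" where
  "bracketings n = {\<phi>. leaves \<phi> = [1..<Suc n]}"

definition valuations :: "nat \<Rightarrow> (nat \<Rightarrow> V4) set" where
  "valuations n = {1..n} \<rightarrow>\<^sub>E UNIV"

definition t :: "nat \<Rightarrow> nat" where
  "t n = card {(\<phi>, \<nu>). \<phi> \<in> bracketings n \<and> \<nu> \<in> valuations n \<and> eval \<nu> \<phi> = V1}"

fun catalan :: "nat \<Rightarrow> nat" where
  "catalan 0 = 1"
| "catalan (Suc n) = (\<Sum>i\<le>n. catalan i * catalan (n - i))"

definition g :: "nat \<Rightarrow> nat" where
  "g n = 4 ^ n * catalan (n - 1)"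

lemma leaves_nonempty: "leaves \<phi> \<noteq> []"
  by (induction \<phi>) auto

lemma leaves_singleton: "{\<phi>. leaves \<phi> = [i]} = {Var i}"
proof -
  have "leaves \<phi> = [i] \<longleftrightarrow> \<phi> = Var i" for \<phi>
    by (cases \<phi>) (auto simp: append_eq_Cons_conv leaves_nonempty)
  then show ?thesis by auto
qed

lemma card_leaves:
  "length xs = Suc n \<Longrightarrow> finite {\<phi>. leaves \<phi> = xs} \<and> card {\<phi>. leaves \<phi> = xs} = catalan n"
proof (induction n arbitrary: xs rule: less_induct)
  case (less n)
  show ?case
  proof (cases n)
    case 0
    with less.prems obtain i where "xs = [i]"
      by (auto simp: length_Suc_conv)
    with 0 show ?thesis by (simp add: leaves_singleton)
  next
    case (Suc m)
    define B where "B ys = {\<phi>. leaves \<phi> = ys}" for ys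
    define P where "P i = case_prod Imp ` (B (take (Suc i) xs) \<times> B (drop (Suc i) xs))" for i
    have fin: "finite (B (take (Suc i) xs))" "card (B (take (Suc i) xs)) = catalan i"
      "finite (B (drop (Suc i) xs))" "card (B (drop (Suc i) xs)) = catalan (m - i)"
      if "i \<le> m" for i
      using less.IH[of i "take (Suc i) xs"] less.IH[of "m - i" "drop (Suc i) xs"]
        less.prems that Suc by (auto simp: B_def)
    have inj: "inj_on (case_prod Imp) X" for X
      by (auto simp: inj_on_def)
    have cP: "finite (P i)" "card (P i) = catalan i * catalan (m - i)" if "i \<le> m" for i
      using fin[OF that] by (simp_all add: P_def card_image inj card_cartesian_product)
    have disj: "P i \<inter> P j = {}" if "i \<le> m" "j \<le> m" "i \<noteq> j" for i j
    proof -
      have "length (take (Suc i) xs) \<noteq> length (take (Suc j) xs)"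
        using that less.prems Suc by simp
      then have "take (Suc i) xs \<noteq> take (Suc j) xs"
        by metis
      then show ?thesis by (auto simp: P_def B_def)
    qed
    have "B xs = (\<Union>i\<in>{..m}. P i)"
    proof (intro equalityI subsetI)
      fix \<phi> assume "\<phi> \<in> B xs"
      then have l: "leaves \<phi> = xs" by (simp add: B_def)
      with less.prems Suc obtain \<alpha> \<beta> where \<phi>: "\<phi> = Imp \<alpha> \<beta>"
        by (cases \<phi>) auto
      have ne: "length (leaves \<alpha>) \<noteq> 0" "length (leaves \<beta>) \<noteq> 0"
        by (simp_all add: leaves_nonempty)
      have len: "length (leaves \<alpha>) + length (leaves \<beta>) = Suc (Suc m)"
        using l \<phi> less.prems Suc by (metis leaves.simps(2) length_append)
      define i where "i = length (leaves \<alpha>) - 1"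
      have i: "Suc i = length (leaves \<alpha>)" "i \<le> m"
        using ne len unfolding i_def by linarith+
      have "\<phi> \<in> P i"
        using l \<phi> by (auto simp: P_def B_def i)
      with i show "\<phi> \<in> (\<Union>i\<in>{..m}. P i)" by blast
    next
      fix \<phi> assume "\<phi> \<in> (\<Union>i\<in>{..m}. P i)"
      then show "\<phi> \<in> B xs" by (auto simp: P_def B_def)
    qed
    moreover have "card (\<Union>i\<in>{..m}. P i) = (\<Sum>i\<le>m. card (P i))"
      by (rule card_UN_disjoint) (use cP disj in auto)
    moreover have "finite (\<Union>i\<in>{..m}. P i)"
      using cP by auto
    ultimately have "finite (B xs) \<and> card (B xs) = catalan (Suc m)"
      using cP by simp
    with Suc show ?thesis by (simp add: B_def)
  qed
qed

lemma card_bracketings: "n \<ge> 1 \<Longrightarrow> card (bracketings n) = catalan (n - 1)"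
  using card_leaves[of "[1..<Suc n]" "n - 1"] by (simp add: bracketings_def)

lemma g_eq_card: "n \<ge> 1 \<Longrightarrow> g n = card (bracketings n \<times> valuations n)"
  by (simp add: g_def card_cartesian_product card_bracketings valuations_def card_PiE
      card_UNIV_V4)

definition T :: "'a::field_char_0 fps" where
  "T = Abs_fps (\<lambda>n. if n \<ge> 1 then of_nat (t n) else 0)"

definition G :: "'a::field_char_0 fps" where
  "G = Abs_fps (\<lambda>n. if n \<ge> 1 then of_nat (g n) else 0)"

text \<open>
  The first argument of \<open>fps_radical\<close> supplies the constant term of the root; here it is
  fixed to \<open>1\<close>, so \<open>fps_sqrt\<close> is meaningful only for series with constant term \<open>1\<close>.
\<close>
definition fps_sqrt :: "'a::field_char_0 fps \<Rightarrow> 'a fps" where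
  "fps_sqrt f = fps_radical (\<lambda>_ _. 1) 2 f"

lemma fps_sqrt_unique:
  assumes "fps_nth f 0 = 1"
  shows "s = fps_sqrt f \<longleftrightarrow> s ^ 2 = f \<and> fps_nth s 0 = 1"
  using radical_unique[of "\<lambda>_ _. 1" 1 f s] assms
  by (auto simp: fps_sqrt_def numeral_2_eq_2)

definition zero_const :: "'a::zero fps set" where
  "zero_const = {u. fps_nth u 0 = 0}"

definition Phi :: "'a::field_char_0 fps \<Rightarrow> 'a fps" where
  "Phi u = u + fps_X / (1 - u)"

definition Psi :: "'a::field_char_0 fps \<Rightarrow> 'a fps" where
  "Psi v = (1 + v - fps_sqrt ((1 - v) ^ 2 + 4 * fps_X)) / 2"

end

theory Submission
  imports Defs
begin

text \<open>
  A bracketing together with a valuation is the same thing as a binary tree with leaves labelled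
  by truth values. For \<open>y \<noteq> 1\<close>, such a tree has value \<open>y\<close> iff it is the leaf \<open>y\<close> or its left
  subtree has a value above \<open>y\<close> and its right subtree has value \<open>y\<close>. So if \<open>S\<^sub>y\<close> counts the
  trees of value at least \<open>y\<close> and \<open>y'\<close> is the successor of \<open>y\<close>, the trees of value \<open>y\<close> have the
  series \<open>A = x + S\<^sub>y\<^sub>' A = x / (1 - S\<^sub>y\<^sub>')\<close>, and \<open>S\<^sub>y = S\<^sub>y\<^sub>' + A = \<Phi>\<^sub>x(S\<^sub>y\<^sub>')\<close>. Three steps along the
  chain lead from \<open>T\<close> to \<open>G\<close>.
\<close>

section \<open>The map \<open>\<Phi>\<^sub>x\<close> and its inverse\<close>

text \<open>Multiplication undoes \<open>/\<close> on power series only when the divisor divides; 2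
  always does, being a unit in characteristic 0.\<close>

lemma fps_half_mult:
  fixes f :: "'a::field_char_0 fps"
  shows "f / 2 * 2 = f"
proof -
  have "(2 :: 'a fps) dvd 1"
    by (simp add: fps_is_unit_iff)
  then have "2 dvd f"
    using dvd_trans one_dvd by blast
  then show ?thesis
    by (rule dvd_div_mult_self)
qed

lemma fps_eq_half_iff:
  fixes f w :: "'a::field_char_0 fps"
  shows "w = f / 2 \<longleftrightarrow> 2 * w = f"
proof
  assume "w = f / 2"
  then show "2 * w = f"
    using fps_half_mult[of f] by (simp only: mult.commute)
next
  assume "2 * w = f"
  then have "2 * w = 2 * (f / 2)"
    using fps_half_mult[of f] by (simp only: mult.commute)
  then show "w = f / 2"
    by (subst (asm) mult_cancel_left) simp
qed

lemma fps_divide_one_minus_mult: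
  fixes f u :: "'a::field_char_0 fps"
  assumes "fps_nth u 0 = 0"
  shows "f / (1 - u) * (1 - u) = f"
proof -
  have "(1 - u) dvd 1"
    using assms by (simp add: fps_is_unit_iff)
  then have "(1 - u) dvd f"
    using dvd_trans one_dvd by blast
  then show ?thesis
    by (rule dvd_div_mult_self)
qed

lemma Phi_in_zero_const: "u \<in> zero_const \<Longrightarrow> Phi u \<in> zero_const"
  by (simp add: zero_const_def Phi_def fps_divide_unit)

lemma Psi_in_zero_const:
  assumes "v \<in> zero_const"
  shows "Psi v \<in> zero_const"
proof -
  let ?D = "(1 - v) ^ 2 + 4 * fps_X"
  have "fps_nth ?D 0 = 1"
    using assms by (simp add: zero_const_def power2_eq_square)
  then have "fps_nth (fps_sqrt ?D) 0 = 1"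
    using fps_sqrt_unique by blast
  \<comment> \<open>Constant terms are compared after clearing the division by 2, where the right
    side gives 1 + 0 - 1.\<close>
  moreover have "Psi v * 2 = 1 + v - fps_sqrt ?D"
    unfolding Psi_def by (rule fps_half_mult)
  then have "fps_nth (Psi v * 2) 0 = fps_nth (1 + v - fps_sqrt ?D) 0"
    by simp
  ultimately show ?thesis
    using assms by (simp add: zero_const_def)
qed

text \<open>Multiplying \<open>w + x/(1 - w) = v\<close> by the nonzero \<open>1 - w\<close> gives a
  quadratic in \<open>w\<close>; completing the square yields \<open>(1 + v - 2w)^2 = ?D\<close>.
  The constant term 1 of \<open>1 + v - 2w\<close> then fixes the sign of the root.\<close>

lemma eq_Psi_iff:
  fixes v w :: "'a::field_char_0 fps"
  assumes v: "v \<in> zero_const" and w: "w \<in> zero_const"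
  shows "w = Psi v \<longleftrightarrow> Phi w = v"
proof -
  let ?D = "(1 - v) ^ 2 + 4 * fps_X"
  define q where "q = fps_X / (1 - w)"
  have q: "q * (1 - w) = fps_X"
    using fps_divide_one_minus_mult w by (auto simp: q_def zero_const_def)
  have w1: "1 - w \<noteq> 0"
    using w by (auto simp: zero_const_def)
  have D0: "fps_nth ?D 0 = 1"
    using v by (simp add: zero_const_def power2_eq_square)
  have s0: "fps_nth (1 + v - 2 * w) 0 = 1"
    using v w by (simp add: zero_const_def)
  have "w = Psi v \<longleftrightarrow> 1 + v - 2 * w = fps_sqrt ?D"
    unfolding Psi_def fps_eq_half_iff by (auto simp: algebra_simps)
  also have "\<dots> \<longleftrightarrow> (1 + v - 2 * w) ^ 2 = ?D"
    using fps_sqrt_unique[OF D0] s0 by blast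
  also have "\<dots> \<longleftrightarrow> 4 * ((1 - w) * (v - (w + q))) = 0"
  proof -
    \<comment> \<open>The two squares differ by \<open>4 (v - w) (1 - w)\<close>; writing x as
      \<open>q (1 - w)\<close> makes \<open>1 - w\<close> a common factor.\<close>
    have "(1 + v - 2 * w) ^ 2 - ?D = 4 * ((1 - w) * (v - (w + q)))"
      unfolding q[symmetric] by (simp add: power2_eq_square algebra_simps)
    then show ?thesis
      by (metis eq_iff_diff_eq_0)
  qed
  also have "\<dots> \<longleftrightarrow> Phi w = v"
    using w1 by (auto simp: Phi_def q_def)
  finally show ?thesis .
qed

lemma bij_betw_Phi: "bij_betw Phi (zero_const :: 'a::field_char_0 fps set) zero_const"
proof (rule bij_betw_byWitness[where f' = "Psi :: 'a fps \<Rightarrow> 'a fps"])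
  show "\<forall>u\<in>zero_const. Psi (Phi u) = (u :: 'a fps)"
  proof
    fix u :: "'a fps" assume "u \<in> zero_const"
    then show "Psi (Phi u) = u"
      using eq_Psi_iff[of "Phi u" u] Phi_in_zero_const[of u] by simp
  qed
  show "\<forall>v\<in>zero_const. Phi (Psi v) = (v :: 'a fps)"
  proof
    fix v :: "'a fps" assume "v \<in> zero_const"
    then show "Phi (Psi v) = v"
      using eq_Psi_iff[of v "Psi v"] Psi_in_zero_const[of v] by simp
  qed
qed (auto intro: Phi_in_zero_const Psi_in_zero_const)

section \<open>Trees with labelled leaves\<close>

text \<open>Without variable names the two subtrees of a node can be chosen independently, with no
  renumbering, as products of series require.\<close>

datatype vtree = Leaf V4 | Node vtree vtree

fun num_leaves :: "vtree \<Rightarrow> nat" where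
  "num_leaves (Leaf v) = 1"
| "num_leaves (Node l r) = num_leaves l + num_leaves r"

fun tree_value :: "vtree \<Rightarrow> V4" where
  "tree_value (Leaf v) = v"
| "tree_value (Node l r) = godel_imp (tree_value l) (tree_value r)"

fun label :: "(nat \<Rightarrow> V4) \<Rightarrow> form \<Rightarrow> vtree" where
  "label \<nu> (Var i) = Leaf (\<nu> i)"
| "label \<nu> (Imp \<phi> \<psi>) = Node (label \<nu> \<phi>) (label \<nu> \<psi>)"

lemma tree_value_label: "tree_value (label \<nu> \<phi>) = eval \<nu> \<phi>"
  by (induction \<phi>) auto

lemma num_leaves_label: "num_leaves (label \<nu> \<phi>) = length (leaves \<phi>)"
  by (induction \<phi>) auto

lemma num_leaves_pos [simp]: "num_leaves s > 0"
  by (induction s) auto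

lemma num_leaves_neq_0 [simp]: "num_leaves s \<noteq> 0"
  using num_leaves_pos[of s] by linarith

lemma label_cong:
  "(\<And>i. i \<in> set (leaves \<phi>) \<Longrightarrow> \<nu> i = \<mu> i) \<Longrightarrow> label \<nu> \<phi> = label \<mu> \<phi>"
  by (induction \<phi>) auto

lemma label_eqD:
  assumes "label \<nu> \<phi> = label \<mu> \<psi>" "leaves \<phi> = leaves \<psi>"
  shows "\<phi> = \<psi> \<and> (\<forall>i\<in>set (leaves \<phi>). \<nu> i = \<mu> i)"
  using assms
proof (induction \<phi> arbitrary: \<psi>)
  case (Var i)
  then show ?case by (cases \<psi>) auto
next
  case (Imp \<alpha> \<beta>)
  from Imp.prems(1) obtain \<gamma> \<delta> where \<psi>: "\<psi> = Imp \<gamma> \<delta>"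
    by (cases \<psi>) auto
  have eq: "label \<nu> \<alpha> = label \<mu> \<gamma>" "label \<nu> \<beta> = label \<mu> \<delta>"
    using Imp.prems(1) \<psi> by simp_all
  \<comment> \<open>Equal labelled trees have equal shape, so both appended leaf lists split at the
    same place.\<close>
  then have "length (leaves \<alpha>) = length (leaves \<gamma>)"
    by (metis num_leaves_label)
  then have "leaves \<alpha> = leaves \<gamma>" "leaves \<beta> = leaves \<delta>"
    using Imp.prems(2) \<psi> by simp_all
  then have "\<alpha> = \<gamma> \<and> (\<forall>i\<in>set (leaves \<alpha>). \<nu> i = \<mu> i)"
    "\<beta> = \<delta> \<and> (\<forall>i\<in>set (leaves \<beta>). \<nu> i = \<mu> i)"
    using Imp.IH eq by blast+
  then show ?case
    using \<psi> by auto
qed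

text \<open>The start index \<open>k\<close> is free because the numbering of a right subtree
  continues that of the left one.\<close>

lemma ex_label: "\<exists>\<phi> \<nu>. leaves \<phi> = [k..<k + num_leaves s] \<and> label \<nu> \<phi> = s"
proof (induction s arbitrary: k)
  case (Leaf v)
  have "leaves (Var k) = [k..<k + num_leaves (Leaf v)] \<and> label (\<lambda>_. v) (Var k) = Leaf v"
    by simp
  then show ?case by blast
next
  case (Node l r)
  let ?m = "k + num_leaves l"
  obtain \<phi> \<nu> where 1: "leaves \<phi> = [k..<?m]" "label \<nu> \<phi> = l"
    using Node.IH(1) by blast
  obtain \<psi> \<mu> where 2: "leaves \<psi> = [?m..<?m + num_leaves r]" "label \<mu> \<psi> = r"
    using Node.IH(2) by blast
  \<comment> \<open>The leaves of \<phi> lie below \<open>?m\<close> and those of \<psi> do not, so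
    the two valuations can be glued.\<close>
  define \<rho> where "\<rho> i = (if i < ?m then \<nu> i else \<mu> i)" for i
  have "label \<rho> \<phi> = l" "label \<rho> \<psi> = r"
    using label_cong[of \<phi> \<rho> \<nu>] label_cong[of \<psi> \<rho> \<mu>] 1 2 by (auto simp: \<rho>_def)
  moreover have "leaves (Imp \<phi> \<psi>) = [k..<k + num_leaves (Node l r)]"
    using 1 2 upt_add_eq_append[of k ?m "num_leaves r"] by (simp add: add.assoc)
  ultimately show ?case
    by (metis label.simps(2))
qed

lemma bij_betw_label:
  "bij_betw (\<lambda>(\<phi>, \<nu>). label \<nu> \<phi>) (bracketings n \<times> valuations n) {s. num_leaves s = n}"
proof (rule bij_betw_imageI)
  show "inj_on (\<lambda>(\<phi>, \<nu>). label \<nu> \<phi>) (bracketings n \<times> valuations n)"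
  proof (rule inj_onI, clarify)
    fix \<phi> \<nu> \<psi> \<mu>
    assume 1: "\<phi> \<in> bracketings n" "\<psi> \<in> bracketings n" "\<nu> \<in> valuations n" "\<mu> \<in> valuations n"
      and 2: "label \<nu> \<phi> = label \<mu> \<psi>"
    have 3: "\<phi> = \<psi> \<and> (\<forall>i\<in>{1..n}. \<nu> i = \<mu> i)"
      using label_eqD[OF 2] 1 by (auto simp: bracketings_def)
    \<comment> \<open>Valuations are \<open>undefined\<close> outside \<open>{1..n}\<close>, so
      agreement on the leaves is equality.\<close>
    moreover have "\<nu> = \<mu>"
      using 1(3,4) 3 unfolding valuations_def by (intro PiE_ext) auto
    ultimately show "\<phi> = \<psi> \<and> \<nu> = \<mu>" by simp
  qed
  show "(\<lambda>(\<phi>, \<nu>). label \<nu> \<phi>) ` (bracketings n \<times> valuations n) = {s. num_leaves s = n}"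
  proof (intro equalityI subsetI)
    fix s assume s: "s \<in> {s. num_leaves s = n}"
    then obtain \<phi> \<nu> where 1: "leaves \<phi> = [1..<Suc n]" "label \<nu> \<phi> = s"
      using ex_label[of 1 s] by auto
    have "label (restrict \<nu> {1..n}) \<phi> = s"
      unfolding 1(2)[symmetric] by (rule label_cong) (simp add: 1(1) del: upt_Suc)
    moreover have "\<phi> \<in> bracketings n" "restrict \<nu> {1..n} \<in> valuations n"
      using 1 by (auto simp: bracketings_def valuations_def)
    ultimately show "s \<in> (\<lambda>(\<phi>, \<nu>). label \<nu> \<phi>) ` (bracketings n \<times> valuations n)"
      by force
  qed (auto simp: num_leaves_label bracketings_def)
qed

text \<open>Since \<open>label\<close> preserves values, the bijection restricts to the pairs of
  value \<open>V1\<close>.\<close>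

lemma t_eq_card_trees: "t n = card {s. num_leaves s = n \<and> tree_value s = V1}"
proof -
  let ?A = "{(\<phi>, \<nu>). \<phi> \<in> bracketings n \<and> \<nu> \<in> valuations n \<and> eval \<nu> \<phi> = V1}"
  let ?f = "\<lambda>(\<phi>, \<nu>). label \<nu> \<phi>"
  have "?f ` ?A = {s \<in> ?f ` (bracketings n \<times> valuations n). tree_value s = V1}"
    by (auto simp: tree_value_label image_iff)
  also have "\<dots> = {s. num_leaves s = n \<and> tree_value s = V1}"
    using bij_betw_imp_surj_on[OF bij_betw_label, of n] by simp
  finally have image: "?f ` ?A = {s. num_leaves s = n \<and> tree_value s = V1}" .
  have "inj_on ?f ?A"
    by (rule inj_on_subset[OF bij_betw_imp_inj_on[OF bij_betw_label[of n]]]) auto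
  then have "card (?f ` ?A) = card ?A"
    by (rule card_image)
  then show ?thesis
    unfolding image t_def by (rule sym)
qed

lemma g_eq_card_trees: "n \<ge> 1 \<Longrightarrow> g n = card {s. num_leaves s = n}"
  using bij_betw_same_card[OF bij_betw_label[of n]] by (simp add: g_eq_card)

section \<open>Generating functions of sets of trees\<close>

lemma finite_V4: "finite (V :: V4 set)"
  by (rule finite_subset[OF subset_UNIV]) (simp add: UNIV_V4)

text \<open>The induction bounds the leaf count: each subtree has a leaf, so a node with at most
  \<open>Suc n\<close> leaves has subtrees with at most \<open>n\<close>. Finiteness makes
  \<open>card\<close> additive in the coefficients below.\<close>

lemma finite_num_leaves: "finite {s. num_leaves s = n}"
proof (rule finite_subset)
  show "{s. num_leaves s = n} \<subseteq> {s. num_leaves s \<le> n}" by auto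
  show "finite {s. num_leaves s \<le> n}"
  proof (induction n)
    case 0
    then show ?case by simp
  next
    case (Suc n)
    let ?A = "{s. num_leaves s \<le> n}"
    have "{s. num_leaves s \<le> Suc n} \<subseteq> range Leaf \<union> case_prod Node ` (?A \<times> ?A)"
    proof
      fix s assume "s \<in> {s. num_leaves s \<le> Suc n}"
      then show "s \<in> range Leaf \<union> case_prod Node ` (?A \<times> ?A)"
      proof (cases s)
        case (Node l r)
        then have "num_leaves l + num_leaves r \<le> Suc n"
          using \<open>s \<in> _\<close> by simp
        then have "num_leaves l \<le> n" "num_leaves r \<le> n"
          using num_leaves_pos[of l] num_leaves_pos[of r] by linarith+
        then have "(l, r) \<in> ?A \<times> ?A"
          by simp
        then show ?thesis
          unfolding Node by force
      qed auto
    qed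
    then show ?case
      by (rule finite_subset) (intro finite_UnI finite_imageI finite_cartesian_product finite_V4 Suc)
  qed
qed

definition tree_gf :: "vtree set \<Rightarrow> 'a::field_char_0 fps" where
  "tree_gf A = Abs_fps (\<lambda>n. of_nat (card {s \<in> A. num_leaves s = n}))"

lemma finite_level: "finite {s \<in> A. num_leaves s = n}"
  by (rule finite_subset[OF _ finite_num_leaves[of n]]) auto

lemma tree_gf_in_zero_const: "tree_gf A \<in> zero_const"
  by (simp add: tree_gf_def zero_const_def)

lemma tree_gf_Un:
  assumes "A \<inter> B = {}"
  shows "tree_gf (A \<union> B) = tree_gf A + tree_gf B"
proof (rule fps_ext)
  fix n
  have "{s \<in> A \<union> B. num_leaves s = n} = {s \<in> A. num_leaves s = n} \<union> {s \<in> B. num_leaves s = n}"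
    by auto
  then have "card {s \<in> A \<union> B. num_leaves s = n}
      = card {s \<in> A. num_leaves s = n} + card {s \<in> B. num_leaves s = n}"
    using assms by (simp only:) (rule card_Un_disjoint, use finite_level in auto)
  then show "fps_nth (tree_gf (A \<union> B)) n = fps_nth (tree_gf A + tree_gf B) n"
    by (simp add: tree_gf_def)
qed

lemma tree_gf_Leaf: "tree_gf (Leaf ` V) = of_nat (card V) * fps_X"
proof (rule fps_ext)
  fix n
  have "{s \<in> Leaf ` V. num_leaves s = n} = (if n = 1 then Leaf ` V else {})"
    by auto
  moreover have "card (Leaf ` V) = card V"
    by (rule card_image) (auto simp: inj_on_def)
  ultimately show "fps_nth (tree_gf (Leaf ` V)) n = fps_nth (of_nat (card V) * fps_X) n"
    by (simp add: tree_gf_def fps_of_nat[symmetric])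
qed

lemma tree_gf_Node: "tree_gf (case_prod Node ` (A \<times> B)) = tree_gf A * tree_gf B"
proof (rule fps_ext)
  fix n
  let ?L = "\<lambda>A n. {s \<in> A. num_leaves s = n}"
  let ?P = "\<lambda>i. ?L A i \<times> ?L B (n - i)"
  \<comment> \<open>The index \<open>i\<close> is the number of leaves of the left subtree, which
    yields the Cauchy product.\<close>
  have "?L (case_prod Node ` (A \<times> B)) n = case_prod Node ` (\<Union>i\<in>{0..n}. ?P i)"
    by (auto simp: image_iff)
  moreover have "inj_on (case_prod Node) X" for X
    by (auto simp: inj_on_def)
  ultimately have "card (?L (case_prod Node ` (A \<times> B)) n) = card (\<Union>i\<in>{0..n}. ?P i)"
    by (simp add: card_image)
  also have "\<dots> = (\<Sum>i=0..n. card (?P i))"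
    by (rule card_UN_disjoint) (auto intro: finite_level)
  finally show "fps_nth (tree_gf (case_prod Node ` (A \<times> B))) n = fps_nth (tree_gf A * tree_gf B) n"
    by (simp add: tree_gf_def fps_mult_nth card_cartesian_product)
qed

section \<open>The series \<open>T\<close> and \<open>G\<close>\<close>

lemma T_eq_tree_gf: "T = tree_gf {s. tree_value s = V1}"
proof (rule fps_ext)
  fix n
  show "fps_nth T n = fps_nth (tree_gf {s. tree_value s = V1}) n"
    by (cases n) (auto simp: T_def tree_gf_def t_eq_card_trees conj_commute)
qed

lemma G_eq_tree_gf: "G = tree_gf UNIV"
proof (rule fps_ext)
  fix n
  show "fps_nth G n = fps_nth (tree_gf UNIV) n"
    \<comment> \<open>By truncated subtraction \<open>g 0\<close> is 1, but \<open>G\<close> has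
      constant term 0, matching the absence of trees without leaves.\<close>
    by (cases n) (auto simp: G_def tree_gf_def g_eq_card_trees)
qed

lemma G_in_zero_const: "G \<in> zero_const"
  by (simp add: G_eq_tree_gf tree_gf_in_zero_const)

text \<open>A tree is one of four labelled leaves or a node over an arbitrary pair of trees.\<close>

lemma G_quadratic: "(G :: 'a::field_char_0 fps) = 4 * fps_X + G ^ 2"
proof -
  have "UNIV = range Leaf \<union> case_prod Node ` (UNIV \<times> UNIV)"
  proof -
    have "s \<in> range Leaf \<union> case_prod Node ` (UNIV \<times> UNIV)" for s
      by (cases s) auto
    then show ?thesis by blast
  qed
  then have "(tree_gf UNIV :: 'a fps) = tree_gf (range Leaf \<union> case_prod Node ` (UNIV \<times> UNIV))"
    by simp
  also have "\<dots> = tree_gf (range Leaf) + tree_gf (case_prod Node ` (UNIV \<times> UNIV))"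
    by (rule tree_gf_Un) auto
  finally show ?thesis
    unfolding G_eq_tree_gf tree_gf_Leaf tree_gf_Node card_UNIV_V4
    by (simp add: power2_eq_square)
qed

lemma G_closed_form: "(G :: 'a::field_char_0 fps) = (1 - fps_sqrt (1 - 16 * fps_X)) / 2"
proof -
  have "(1 - 2 * G) ^ 2 = 1 - 4 * (G - G ^ 2 :: 'a fps)"
    by (simp add: power2_eq_square algebra_simps)
  also have "G - G ^ 2 = (4 * fps_X :: 'a fps)"
    using G_quadratic[where 'a = 'a] by (simp add: algebra_simps)
  finally have "(1 - 2 * G) ^ 2 = (1 - 16 * fps_X :: 'a fps)"
    by simp
  \<comment> \<open>The constant term decides between the two square roots.\<close>
  moreover have "fps_nth (1 - 2 * G :: 'a fps) 0 = 1"
    using G_in_zero_const[where 'a = 'a] by (simp add: zero_const_def)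
  ultimately have "1 - 2 * G = fps_sqrt (1 - 16 * fps_X :: 'a fps)"
    by (subst fps_sqrt_unique) auto
  then show ?thesis
    unfolding fps_eq_half_iff by (simp add: algebra_simps)
qed

section \<open>Descent along the chain of truth values\<close>

lemma trees_value_eq:
  assumes "y \<noteq> V1"
  shows "{s. tree_value s = y}
    = Leaf ` {y} \<union> case_prod Node ` ({s. y < tree_value s} \<times> {s. tree_value s = y})"
proof -
  have "tree_value s = y \<longleftrightarrow>
    s \<in> Leaf ` {y} \<union> case_prod Node ` ({s. y < tree_value s} \<times> {s. tree_value s = y})" for s
    \<comment> \<open>As \<open>y \<noteq> V1\<close>, the first branch of \<open>godel_imp\<close>
      cannot produce \<open>y\<close>.\<close>
    using assms by (cases s) (auto simp: godel_imp_def not_le split: if_splits)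
  then show ?thesis by blast
qed

lemma tree_gf_ge_eq_Phi:
  assumes "y \<noteq> V1"
  shows "tree_gf {s. y \<le> tree_value s} = Phi (tree_gf {s. y < tree_value s})"
proof -
  define S :: "'a fps" where "S = tree_gf {s. y < tree_value s}"
  define A :: "'a fps" where "A = tree_gf {s. tree_value s = y}"
  have "A = tree_gf (Leaf ` {y}
      \<union> case_prod Node ` ({s. y < tree_value s} \<times> {s. tree_value s = y}))"
    unfolding A_def using trees_value_eq[OF assms] by (rule arg_cong)
  also have "\<dots> = tree_gf (Leaf ` {y})
      + tree_gf (case_prod Node ` ({s. y < tree_value s} \<times> {s. tree_value s = y}))"
    by (rule tree_gf_Un) auto
  \<comment> \<open>The equation is linear in \<open>A\<close>, as only the right subtree must again
    have value \<open>y\<close>; division by the unit \<open>1 - S\<close> solves it.\<close>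
  finally have "A = fps_X + S * A"
    unfolding tree_gf_Leaf tree_gf_Node S_def A_def by simp
  then have A: "A * (1 - S) = fps_X"
    by (simp add: algebra_simps)
  have S0: "fps_nth S 0 = 0"
    using tree_gf_in_zero_const by (auto simp: S_def zero_const_def)
  then have "1 - S \<noteq> 0"
    by auto
  with A fps_divide_one_minus_mult[OF S0, of fps_X] have "A = fps_X / (1 - S)"
    by (metis mult_right_cancel)
  moreover have "{s. y \<le> tree_value s} = {s. y < tree_value s} \<union> {s. tree_value s = y}"
    by auto
  then have "tree_gf {s. y \<le> tree_value s} = S + A"
    unfolding S_def A_def by (simp only:) (rule tree_gf_Un, auto)
  ultimately show ?thesis
    by (simp add: Phi_def S_def)
qed

lemma Psi_tree_gf_ge:
  assumes "y \<noteq> V1"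
  shows "Psi (tree_gf {s. y \<le> tree_value s}) = tree_gf {s. y < tree_value s}"
  using tree_gf_ge_eq_Phi[OF assms] eq_Psi_iff tree_gf_in_zero_const by metis

lemma T_eq_Psi_iterate: "(T :: 'a::field_char_0 fps) = (Psi ^^ 3) G"
proof -
  \<comment> \<open>Being above a value means being at least its successor; at the ends,
    \<open>V0 \<le> v\<close> gives all trees and \<open>Vb < v\<close> those counted by
    \<open>T\<close>.\<close>
  have less_iff: "V0 < v \<longleftrightarrow> Va \<le> v" "Va < v \<longleftrightarrow> Vb \<le> v" "Vb < v \<longleftrightarrow> v = V1" "V0 \<le> v" for v
    by (cases v; simp add: less_V4_def less_eq_V4_def)+
  have "Psi G = (tree_gf {s. Va \<le> tree_value s} :: 'a fps)"
    using Psi_tree_gf_ge[of V0] by (simp add: G_eq_tree_gf less_iff)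
  moreover have "Psi (tree_gf {s. Va \<le> tree_value s}) = (tree_gf {s. Vb \<le> tree_value s} :: 'a fps)"
    using Psi_tree_gf_ge[of Va] by (simp add: less_iff)
  moreover have "Psi (tree_gf {s. Vb \<le> tree_value s}) = (T :: 'a fps)"
    using Psi_tree_gf_ge[of Vb] by (simp add: T_eq_tree_gf less_iff)
  ultimately show ?thesis
    by (simp add: numeral_3_eq_3)
qed

theorem proposition3:
  shows "bij_betw Phi (zero_const :: 'a::field_char_0 fps set) zero_const
    \<and> (\<forall>v\<in>zero_const. inv_into zero_const Phi v = (Psi v :: 'a fps))
    \<and> (\<forall>v\<in>zero_const. \<forall>w :: 'a fps. w = Psi v \<longleftrightarrow> Phi w = v \<and> fps_nth w 0 = 0)
    \<and> (T :: 'a fps) = (Psi ^^ 3) G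
    \<and> (G :: 'a fps) = (1 - fps_sqrt (1 - 16 * fps_X)) / 2"
proof (intro conjI ballI allI)
  show "bij_betw Phi (zero_const :: 'a fps set) zero_const"
    by (rule bij_betw_Phi)
next
  fix v :: "'a fps" assume v: "v \<in> zero_const"
  show "inv_into zero_const Phi v = Psi v"
    using v Psi_in_zero_const[OF v] eq_Psi_iff
    by (intro inv_into_f_eq bij_betw_imp_inj_on[OF bij_betw_Phi]) auto
next
  fix v w :: "'a fps" assume v: "v \<in> zero_const"
  \<comment> \<open>Here \<open>w\<close> is any series: its membership in \<open>zero_const\<close>
    follows from \<open>Psi_in_zero_const\<close> in one direction and is assumed in the
    other.\<close>
  have "w = Psi v \<longleftrightarrow> w \<in> zero_const \<and> Phi w = v"
    using v Psi_in_zero_const[OF v] eq_Psi_iff by blast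
  then show "w = Psi v \<longleftrightarrow> Phi w = v \<and> fps_nth w 0 = 0"
    by (auto simp: zero_const_def)
next
  show "(T :: 'a fps) = (Psi ^^ 3) G"
    by (rule T_eq_Psi_iterate)
next
  show "(G :: 'a fps) = (1 - fps_sqrt (1 - 16 * fps_X)) / 2"
    by (rule G_closed_form)
qed

end
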